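(* For an entire function $h$ with $e^xh(x)=\sum_{m\ge0}\frac{B_m}{m!}x^m$ ($B_m$ real), define $E(h;r)=e^{-r}\sum_{m=0}^\infty\frac{|B_m|}{m!}r^m$ for $r\ge0$, and write $E_x(h(px);r)$ for $E$ applied to the function $x\mapsto h(px)$. Let $f,g$ be such entire functions and let $p,q\ge0$ with $p+q=1$. Then for all $r\ge0$: (1) for all $a,b\in\mathbb R$, $E_x(af(x)+bg(x);r)\le|a|E(f;r)+|b|E(g;r)$; (2) $E_x(f(px)g(qx);r)\le E(f;rp)\,E(g;rq)$; (3) $E_x(f(px);r)\le E(f;rp)$; (4) $\left|\frac{d}{dr}E(f;r)\right|\le E(f';r)$. *)

theory Defs
  imports "HOL-Complex_Analysis.Complex_Analysis"
begin

definition exp_gf_coeffs :: "(complex \<Rightarrow> complex) \<Rightarrow> (nat \<Rightarrow> real) \<Rightarrow> bool" where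
  "exp_gf_coeffs h B \<longleftrightarrow>
     (\<forall>x. (\<lambda>m. complex_of_real (B m) / fact m * x ^ m) sums (exp x * h x))"

definition admissible :: "(complex \<Rightarrow> complex) \<Rightarrow> bool" where
  "admissible h \<longleftrightarrow> h holomorphic_on UNIV \<and> (\<exists>B. exp_gf_coeffs h B)"

lemma exp_gf_coeffs_deriv:
  assumes "exp_gf_coeffs h B"
  shows "complex_of_real (B m) = (deriv ^^ m) (\<lambda>x. exp x * h x) 0"
proof -
  have "(\<lambda>x. exp x * h x) has_fps_expansion Abs_fps (\<lambda>m. complex_of_real (B m) / fact m)"
  proof (rule has_fps_expansionI)
    show "\<forall>\<^sub>F u in nhds 0. (\<lambda>n. fps_nth (Abs_fps (\<lambda>m. complex_of_real (B m) / fact m)) n * u ^ n)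
            sums (exp u * h u)"
      using assms by (simp add: exp_gf_coeffs_def)
  qed
  from fps_nth_fps_expansion[OF this, of m] show ?thesis
    by simp
qed

text \<open>The coefficients are unique, so the definite description below is meaningful for every
  admissible function.\<close>

lemma exp_gf_coeffs_unique:
  assumes "exp_gf_coeffs h B" and "exp_gf_coeffs h C"
  shows "B = C"
proof
  fix m
  have "complex_of_real (B m) = complex_of_real (C m)"
    by (simp only: exp_gf_coeffs_deriv[OF assms(1)] exp_gf_coeffs_deriv[OF assms(2)])
  then show "B m = C m"
    by simp
qed

definition coeff_of :: "(complex \<Rightarrow> complex) \<Rightarrow> nat \<Rightarrow> real" where
  "coeff_of h = (THE B. exp_gf_coeffs h B)"

lemma coeff_of_eq:
  assumes "exp_gf_coeffs h B"
  shows "coeff_of h = B"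
  unfolding coeff_of_def using assms exp_gf_coeffs_unique by blast

definition E :: "(complex \<Rightarrow> complex) \<Rightarrow> real \<Rightarrow> real" where
  "E h r = exp (- r) * (\<Sum>m. \<bar>coeff_of h m\<bar> / fact m * r ^ m)"

lemma E_summable:
  assumes "admissible h"
  shows "summable (\<lambda>m. \<bar>coeff_of h m\<bar> / fact m * r ^ m)"
proof -
  obtain B where B: "exp_gf_coeffs h B"
    using assms by (auto simp: admissible_def)
  have "summable (\<lambda>m. complex_of_real (B m) / fact m * complex_of_real (\<bar>r\<bar> + 1) ^ m)"
    using B unfolding exp_gf_coeffs_def by (meson sums_summable)
  moreover have "norm (complex_of_real r) < norm (complex_of_real (\<bar>r\<bar> + 1))"
    by simp
  ultimately have "summable (\<lambda>m. norm (complex_of_real (B m) / fact m * complex_of_real r ^ m))"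
    by (rule powser_insidea)
  then have "summable (\<lambda>m. norm (\<bar>B m\<bar> / fact m * r ^ m))"
    by (simp add: norm_mult norm_divide norm_power power_abs abs_mult)
  then show ?thesis
    using coeff_of_eq[OF B] summable_norm_cancel by metis
qed

end

theory Submission
  imports Defs
begin

text \<open>All four bounds are the triangle inequality applied to explicit coefficients: those of
  \<open>a f + b g\<close> are \<open>a A\<^sub>m + b B\<^sub>m\<close>; since \<open>p + q = 1\<close>, we have
  \<open>e\<^sup>x f(p x) g(q x) = (e\<^bsup>p x\<^esup> f(p x)) (e\<^bsup>q x\<^esup> g(q x))\<close>, whose coefficients form
  a Cauchy product; (3) is (2) with \<open>g = 1\<close>, for which \<open>E\<close> is constantly \<open>1\<close>; and
  \<open>e\<^sup>x f' = (e\<^sup>x f)' - e\<^sup>x f\<close> has coefficients \<open>A\<^sub>m\<^sub>+\<^sub>1 - A\<^sub>m\<close>, while the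
  derivative of \<open>E(f; r)\<close> involves \<open>\<bar>A\<^sub>m\<^sub>+\<^sub>1\<bar> - \<bar>A\<^sub>m\<bar>\<close>.\<close>

section \<open>Convergence of the coefficient series\<close>

lemma E_eq:
  assumes "exp_gf_coeffs h B"
  shows "E h r = exp (- r) * (\<Sum>m. \<bar>B m\<bar> / fact m * r ^ m)"
  by (simp add: E_def coeff_of_eq[OF assms])

text \<open>A power series converging at \<open>norm x + 1\<close> converges absolutely at every
  point of smaller modulus. The Cauchy product needs this absolute form.\<close>

lemma exp_gf_coeffs_summable_norm:
  assumes "exp_gf_coeffs h B"
  shows "summable (\<lambda>m. norm (complex_of_real (B m) / fact m * x ^ m))"
proof (rule powser_insidea)
  show "summable (\<lambda>m. complex_of_real (B m) / fact m * complex_of_real (norm x + 1) ^ m)"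
    using assms unfolding exp_gf_coeffs_def by (meson sums_summable)
  show "norm x < norm (complex_of_real (norm x + 1))"
    by (metis abs_of_nonneg add_nonneg_nonneg less_add_one norm_ge_zero norm_of_real zero_le_one)
qed

text \<open>The sign of \<open>r\<close> is left free because the series is later differentiated
  termwise, which asks for convergence on the whole real line.\<close>

lemma exp_gf_coeffs_summable:
  assumes "exp_gf_coeffs h B"
  shows "summable (\<lambda>m. \<bar>B m\<bar> / fact m * r ^ m)"
proof -
  have "summable (\<lambda>m. \<bar>B m\<bar> / fact m * \<bar>r\<bar> ^ m)"
    using exp_gf_coeffs_summable_norm[OF assms, of "complex_of_real r"]
    by (simp add: norm_mult norm_divide norm_power)
  then have "summable (\<lambda>m. norm (\<bar>B m\<bar> / fact m * r ^ m))"
    by (simp add: abs_mult power_abs)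
  then show ?thesis
    by (rule summable_norm_cancel)
qed

section \<open>Linear combinations\<close>

lemma exp_gf_coeffs_linear:
  assumes "exp_gf_coeffs f A" and "exp_gf_coeffs g B"
  shows "exp_gf_coeffs (\<lambda>x. complex_of_real a * f x + complex_of_real b * g x)
           (\<lambda>m. a * A m + b * B m)"
  unfolding exp_gf_coeffs_def
proof
  fix x
  have "(\<lambda>m. complex_of_real a * (complex_of_real (A m) / fact m * x ^ m)
           + complex_of_real b * (complex_of_real (B m) / fact m * x ^ m))
        sums (complex_of_real a * (exp x * f x) + complex_of_real b * (exp x * g x))"
    using assms unfolding exp_gf_coeffs_def by (intro sums_add sums_mult) auto
  then show "(\<lambda>m. complex_of_real (a * A m + b * B m) / fact m * x ^ m)
        sums (exp x * (complex_of_real a * f x + complex_of_real b * g x))"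
    by (simp add: algebra_simps add_divide_distrib)
qed

lemma E_linear_le:
  assumes f: "exp_gf_coeffs f A" and g: "exp_gf_coeffs g B" and r: "r \<ge> 0"
  shows "E (\<lambda>x. complex_of_real a * f x + complex_of_real b * g x) r \<le> \<bar>a\<bar> * E f r + \<bar>b\<bar> * E g r"
proof -
  note fg = exp_gf_coeffs_linear[OF f g, of a b]
  note sf = exp_gf_coeffs_summable[OF f, of r] and sg = exp_gf_coeffs_summable[OF g, of r]
  have "(\<Sum>m. \<bar>a * A m + b * B m\<bar> / fact m * r ^ m)
      \<le> (\<Sum>m. \<bar>a\<bar> * (\<bar>A m\<bar> / fact m * r ^ m) + \<bar>b\<bar> * (\<bar>B m\<bar> / fact m * r ^ m))"
  proof (intro suminf_le allI)
    fix m
    \<comment> \<open>The triangle inequality is scaled by the weight \<open>r ^ m / fact m\<close>,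
      nonnegative since \<open>r \<ge> 0\<close>.\<close>
    have "\<bar>a * A m + b * B m\<bar> * (r ^ m / fact m) \<le> (\<bar>a\<bar> * \<bar>A m\<bar> + \<bar>b\<bar> * \<bar>B m\<bar>) * (r ^ m / fact m)"
      using r by (intro mult_right_mono) (auto simp flip: abs_mult)
    then show "\<bar>a * A m + b * B m\<bar> / fact m * r ^ m
      \<le> \<bar>a\<bar> * (\<bar>A m\<bar> / fact m * r ^ m) + \<bar>b\<bar> * (\<bar>B m\<bar> / fact m * r ^ m)"
      by (simp add: algebra_simps)
  qed (intro summable_add summable_mult sf sg exp_gf_coeffs_summable[OF fg])+
  also have "\<dots> = \<bar>a\<bar> * (\<Sum>m. \<bar>A m\<bar> / fact m * r ^ m) + \<bar>b\<bar> * (\<Sum>m. \<bar>B m\<bar> / fact m * r ^ m)"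
    using sf sg by (simp only: suminf_add[symmetric] suminf_mult summable_mult)
  finally have "exp (- r) * (\<Sum>m. \<bar>a * A m + b * B m\<bar> / fact m * r ^ m) \<le> exp (- r) * \<dots>"
    by (rule mult_left_mono) simp
  then show ?thesis
    by (simp add: E_eq[OF fg] E_eq[OF f] E_eq[OF g] algebra_simps)
qed

section \<open>Products of rescaled functions\<close>

text \<open>The inner sum is the ordinary Cauchy coefficient of the two series; the factor
  \<open>fact m\<close> compensates the division by \<open>fact m\<close> built into
  \<open>exp_gf_coeffs\<close>.\<close>

lemma exp_gf_coeffs_scaled_mult:
  fixes p q :: real
  assumes f: "exp_gf_coeffs f A" and g: "exp_gf_coeffs g B" and pq: "p + q = 1"
  shows "exp_gf_coeffs (\<lambda>x. f (complex_of_real p * x) * g (complex_of_real q * x))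
           (\<lambda>m. fact m * (\<Sum>i\<le>m. (A i / fact i * p ^ i) * (B (m - i) / fact (m - i) * q ^ (m - i))))"
  unfolding exp_gf_coeffs_def
proof
  fix x
  define P Q where "P = complex_of_real p" and "Q = complex_of_real q"
  have PQ: "P + Q = 1"
    using pq by (simp add: P_def Q_def flip: of_real_add)
  have "(\<lambda>m. \<Sum>i\<le>m. (complex_of_real (A i) / fact i * (P * x) ^ i)
              * (complex_of_real (B (m - i)) / fact (m - i) * (Q * x) ^ (m - i)))
        sums ((\<Sum>m. complex_of_real (A m) / fact m * (P * x) ^ m)
              * (\<Sum>m. complex_of_real (B m) / fact m * (Q * x) ^ m))"
    by (intro Cauchy_product_sums exp_gf_coeffs_summable_norm[OF f] exp_gf_coeffs_summable_norm[OF g])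
  also have "(\<Sum>m. complex_of_real (A m) / fact m * (P * x) ^ m) = exp (P * x) * f (P * x)"
    using f unfolding exp_gf_coeffs_def by (metis sums_unique)
  also have "(\<Sum>m. complex_of_real (B m) / fact m * (Q * x) ^ m) = exp (Q * x) * g (Q * x)"
    using g unfolding exp_gf_coeffs_def by (metis sums_unique)
  also have "exp (P * x) * f (P * x) * (exp (Q * x) * g (Q * x))
      = exp (P * x + Q * x) * (f (P * x) * g (Q * x))"
    by (simp add: exp_add)
  also have "P * x + Q * x = x"
    using PQ by (simp flip: distrib_right)
  also have "(\<lambda>m. \<Sum>i\<le>m. (complex_of_real (A i) / fact i * (P * x) ^ i)
              * (complex_of_real (B (m - i)) / fact (m - i) * (Q * x) ^ (m - i)))
      = (\<lambda>m. complex_of_real (fact m * (\<Sum>i\<le>m. (A i / fact i * p ^ i)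
              * (B (m - i) / fact (m - i) * q ^ (m - i)))) / fact m * x ^ m)"
  proof
    fix m
    have "complex_of_real (A i) / fact i * (P * x) ^ i
            * (complex_of_real (B (m - i)) / fact (m - i) * (Q * x) ^ (m - i))
        = complex_of_real ((A i / fact i * p ^ i) * (B (m - i) / fact (m - i) * q ^ (m - i))) * x ^ m"
      if "i \<le> m" for i
    proof -
      \<comment> \<open>Every term of the inner sum thus carries the same power
        \<open>x ^ m\<close>, which can be pulled out of the sum.\<close>
      have "x ^ m = x ^ i * x ^ (m - i)"
        using that by (simp flip: power_add)
      then show ?thesis
        by (simp add: P_def Q_def power_mult_distrib)
    qed
    then have "(\<Sum>i\<le>m. (complex_of_real (A i) / fact i * (P * x) ^ i)
              * (complex_of_real (B (m - i)) / fact (m - i) * (Q * x) ^ (m - i)))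
      = (\<Sum>i\<le>m. complex_of_real ((A i / fact i * p ^ i)
              * (B (m - i) / fact (m - i) * q ^ (m - i))) * x ^ m)"
      by (intro sum.cong) auto
    then show "(\<Sum>i\<le>m. (complex_of_real (A i) / fact i * (P * x) ^ i)
              * (complex_of_real (B (m - i)) / fact (m - i) * (Q * x) ^ (m - i)))
      = complex_of_real (fact m * (\<Sum>i\<le>m. (A i / fact i * p ^ i)
              * (B (m - i) / fact (m - i) * q ^ (m - i)))) / fact m * x ^ m"
      by (simp only: of_real_mult of_real_sum of_real_fact sum_distrib_right[symmetric]) simp
  qed
  finally show "(\<lambda>m. complex_of_real (fact m * (\<Sum>i\<le>m. (A i / fact i * p ^ i)
              * (B (m - i) / fact (m - i) * q ^ (m - i)))) / fact m * x ^ m)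
      sums (exp x * (f (complex_of_real p * x) * g (complex_of_real q * x)))"
    by (simp add: P_def Q_def)
qed

text \<open>The triangle inequality inside each Cauchy coefficient bounds the left series by the
  Cauchy product of the series at \<open>r * p\<close> and \<open>r * q\<close>, which factors by
  absolute convergence.\<close>

lemma E_scaled_mult_le:
  fixes p q :: real
  assumes f: "exp_gf_coeffs f A" and g: "exp_gf_coeffs g B"
    and p: "p \<ge> 0" and q: "q \<ge> 0" and pq: "p + q = 1" and r: "r \<ge> 0"
  shows "E (\<lambda>x. f (complex_of_real p * x) * g (complex_of_real q * x)) r
           \<le> E f (r * p) * E g (r * q)"
proof -
  define C where
    "C m = (\<Sum>i\<le>m. (A i / fact i * p ^ i) * (B (m - i) / fact (m - i) * q ^ (m - i)))" for m
  note fg = exp_gf_coeffs_scaled_mult[OF f g pq, folded C_def]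
  let ?a = "\<lambda>m. \<bar>A m\<bar> / fact m * (r * p) ^ m" and ?b = "\<lambda>m. \<bar>B m\<bar> / fact m * (r * q) ^ m"
  have sa: "summable (\<lambda>m. norm (?a m))" and sb: "summable (\<lambda>m. norm (?b m))"
    using exp_gf_coeffs_summable[OF f, of "r * p"] exp_gf_coeffs_summable[OF g, of "r * q"]
      p q r by (simp_all add: abs_mult)
  have "(\<Sum>m. \<bar>fact m * C m\<bar> / fact m * r ^ m) \<le> (\<Sum>m. \<Sum>i\<le>m. ?a i * ?b (m - i))"
  proof (intro suminf_le allI)
    fix m
    have "\<bar>C m\<bar> * r ^ m
        \<le> (\<Sum>i\<le>m. \<bar>(A i / fact i * p ^ i) * (B (m - i) / fact (m - i) * q ^ (m - i))\<bar>) * r ^ m"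
      unfolding C_def using r by (intro mult_right_mono sum_abs) auto
    also have "\<dots> = (\<Sum>i\<le>m. ?a i * ?b (m - i))"
      unfolding sum_distrib_right
    \<comment> \<open>Splitting \<open>r ^ m\<close> turns \<open>p ^ i\<close> into
      \<open>(r * p) ^ i\<close> and \<open>q ^ (m - i)\<close> into
      \<open>(r * q) ^ (m - i)\<close>; as \<open>p\<close> and \<open>q\<close> are nonnegative,
      the absolute value affects only \<open>A\<close> and \<open>B\<close>.\<close>
    proof (intro sum.cong refl)
      fix i assume "i \<in> {..m}"
      then have "r ^ m = r ^ i * r ^ (m - i)"
        by (simp flip: power_add)
      then show "\<bar>(A i / fact i * p ^ i) * (B (m - i) / fact (m - i) * q ^ (m - i))\<bar> * r ^ m
          = ?a i * ?b (m - i)"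
        using p q by (simp add: abs_mult power_mult_distrib)
    qed
    finally show "\<bar>fact m * C m\<bar> / fact m * r ^ m \<le> (\<Sum>i\<le>m. ?a i * ?b (m - i))"
      by (simp add: abs_mult)
  qed (use exp_gf_coeffs_summable[OF fg] summable_Cauchy_product[OF sa sb] in auto)
  also have "\<dots> = (\<Sum>m. ?a m) * (\<Sum>m. ?b m)"
    using Cauchy_product[OF sa sb] by simp
  finally have "exp (- r) * (\<Sum>m. \<bar>fact m * C m\<bar> / fact m * r ^ m) \<le> exp (- r) * \<dots>"
    by (rule mult_left_mono) simp
  \<comment> \<open>The prefactor splits into those of the two factors, again by
    \<open>p + q = 1\<close>.\<close>
  moreover have "exp (- r) = exp (- (r * p)) * exp (- (r * q))"
  proof -
    have "r * p + r * q = r"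
      using pq by (simp flip: distrib_left)
    then have "- r = - (r * p) + - (r * q)"
      by linarith
    then show ?thesis
      by (simp only: exp_add)
  qed
  ultimately show ?thesis
    by (simp add: E_eq[OF fg] E_eq[OF f] E_eq[OF g] mult.assoc mult.left_commute)
qed

lemma exp_gf_coeffs_one: "exp_gf_coeffs (\<lambda>_. 1) (\<lambda>_. 1)"
  using exp_converges[where 'a = complex] unfolding exp_gf_coeffs_def by (simp add: scaleR_conv_of_real divide_inverse)

lemma E_one: "E (\<lambda>_. 1) r = 1"
proof -
  have "(\<Sum>m. r ^ m / fact m) = exp r"
    using exp_converges[of r] by (simp add: sums_iff field_simps)
  then show ?thesis
    by (simp add: E_eq[OF exp_gf_coeffs_one] flip: exp_add)
qed

section \<open>Derivatives\<close>

text \<open>The factor \<open>Suc m\<close> from differentiation cancels against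
  \<open>fact (Suc m)\<close>, so in this normalisation differentiating is an index shift. The
  general field type serves both the complex and the real series.\<close>

lemma diffs_divide_fact:
  "diffs (\<lambda>m. a m / fact m :: 'a :: real_normed_field) m = a (Suc m) / fact m"
proof -
  have "(of_nat (Suc m) :: 'a) \<noteq> 0"
    by (rule of_nat_neq_0)
  then show ?thesis
    by (simp add: diffs_def del: of_nat_Suc)
qed

lemma exp_gf_coeffs_deriv_diff:
  assumes hol: "f holomorphic_on UNIV" and f: "exp_gf_coeffs f A"
  shows "exp_gf_coeffs (deriv f) (\<lambda>m. A (Suc m) - A m)"
  unfolding exp_gf_coeffs_def
proof
  fix x
  let ?c = "\<lambda>m. complex_of_real (A m) / fact m"
  have s: "(\<lambda>m. ?c m * y ^ m) sums (exp y * f y)" for y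
    using f by (simp add: exp_gf_coeffs_def)
  have eq: "(\<lambda>y. \<Sum>m. ?c m * y ^ m) = (\<lambda>y. exp y * f y)"
    using s by (simp add: sums_iff)
  \<comment> \<open>The derivative of \<open>exp y * f y\<close> is computed termwise here and by
    the product rule next; uniqueness of derivatives equates the two.\<close>
  have "((\<lambda>y. exp y * f y) has_field_derivative (\<Sum>m. diffs ?c m * x ^ m)) (at x)"
    using termdiffs_strong_converges_everywhere[of ?c x] s unfolding eq by (blast intro: sums_summable)
  moreover have "((\<lambda>y. exp y * f y) has_field_derivative exp x * f x + exp x * deriv f x) (at x)"
    using holomorphic_derivI[OF hol open_UNIV UNIV_I]
    by (auto intro!: derivative_eq_intros)
  ultimately have "(\<Sum>m. diffs ?c m * x ^ m) = exp x * f x + exp x * deriv f x"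
    by (rule DERIV_unique)
  moreover have "summable (\<lambda>m. diffs ?c m * x ^ m)"
    using s by (intro termdiff_converges_all) (blast intro: sums_summable)
  ultimately have "(\<lambda>m. diffs ?c m * x ^ m) sums (exp x * f x + exp x * deriv f x)"
    by (simp add: sums_iff)
  \<comment> \<open>Subtracting the series of \<open>exp x * f x\<close> leaves
    \<open>exp x * deriv f x\<close>.\<close>
  from sums_diff[OF this s[of x]]
  show "(\<lambda>m. complex_of_real (A (Suc m) - A m) / fact m * x ^ m) sums (exp x * deriv f x)"
    by (simp add: diffs_divide_fact algebra_simps diff_divide_distrib)
qed

text \<open>The product rule gives \<open>exp (- r)\<close> times the differentiated series minus
  the original one. The derivative is two-sided at every real \<open>r\<close>.\<close>

lemma E_has_real_derivative:
  assumes f: "exp_gf_coeffs f A"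
  shows "(E f has_real_derivative exp (- r) * (\<Sum>m. (\<bar>A (Suc m)\<bar> - \<bar>A m\<bar>) / fact m * r ^ m)) (at r)"
proof -
  let ?c = "\<lambda>m. \<bar>A m\<bar> / fact m"
  let ?S = "\<lambda>r. \<Sum>m. ?c m * r ^ m"
  note s = exp_gf_coeffs_summable[OF f]
  have sd: "summable (\<lambda>m. diffs ?c m * r ^ m)"
    using s by (rule termdiff_converges_all)
  have split: "(\<lambda>m. (\<bar>A (Suc m)\<bar> - \<bar>A m\<bar>) / fact m * r ^ m) = (\<lambda>m. diffs ?c m * r ^ m - ?c m * r ^ m)"
    by (simp add: diffs_divide_fact algebra_simps diff_divide_distrib)
  have "(?S has_real_derivative (\<Sum>m. diffs ?c m * r ^ m)) (at r)"
    using s by (rule termdiffs_strong_converges_everywhere)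
  then have "((\<lambda>r. exp (- r) * ?S r) has_real_derivative
      exp (- r) * ((\<Sum>m. diffs ?c m * r ^ m) - ?S r)) (at r)"
    by (auto intro!: derivative_eq_intros simp: algebra_simps)
  moreover have "E f = (\<lambda>r. exp (- r) * ?S r)"
    using E_eq[OF f] by auto
  ultimately show ?thesis
    unfolding split using suminf_diff[OF sd s] by simp
qed

text \<open>This is the reverse triangle inequality, term by term: the dominating series has the
  coefficients of \<open>deriv f\<close>.\<close>

lemma E_derivative_le:
  assumes hol: "f holomorphic_on UNIV" and f: "exp_gf_coeffs f A" and r: "r \<ge> 0"
  shows "\<bar>exp (- r) * (\<Sum>m. (\<bar>A (Suc m)\<bar> - \<bar>A m\<bar>) / fact m * r ^ m)\<bar> \<le> E (deriv f) r"
proof -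
  note f' = exp_gf_coeffs_deriv_diff[OF hol f]
  have "norm (\<Sum>m. (\<bar>A (Suc m)\<bar> - \<bar>A m\<bar>) / fact m * r ^ m)
      \<le> (\<Sum>m. \<bar>A (Suc m) - A m\<bar> / fact m * r ^ m)"
  proof (rule norm_suminf_le)
    fix m
    show "norm ((\<bar>A (Suc m)\<bar> - \<bar>A m\<bar>) / fact m * r ^ m) \<le> \<bar>A (Suc m) - A m\<bar> / fact m * r ^ m"
      using r by (auto simp: abs_mult intro!: mult_right_mono divide_right_mono)
  qed (rule exp_gf_coeffs_summable[OF f'])
  then show ?thesis
    by (simp add: E_eq[OF f'] abs_mult)
qed

theorem theorem11:
  fixes f g :: "complex \<Rightarrow> complex" and p q :: real
  assumes "admissible f" and "admissible g"
    and "p \<ge> 0" and "q \<ge> 0" and "p + q = 1"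
  shows "\<forall>r\<ge>0.
      (\<forall>a b :: real. E (\<lambda>x. complex_of_real a * f x + complex_of_real b * g x) r
                       \<le> \<bar>a\<bar> * E f r + \<bar>b\<bar> * E g r)
    \<and> E (\<lambda>x. f (complex_of_real p * x) * g (complex_of_real q * x)) r \<le> E f (r * p) * E g (r * q)
    \<and> E (\<lambda>x. f (complex_of_real p * x)) r \<le> E f (r * p)
    \<and> (\<exists>D. (E f has_real_derivative D) (at r within {0..}) \<and> \<bar>D\<bar> \<le> E (deriv f) r)"
proof (intro allI impI conjI)
  fix r :: real
  assume r: "r \<ge> 0"
  obtain A B where f: "exp_gf_coeffs f A" and g: "exp_gf_coeffs g B" and hol: "f holomorphic_on UNIV"
    using assms(1,2) by (auto simp: admissible_def)
  show "E (\<lambda>x. complex_of_real a * f x + complex_of_real b * g x) r \<le> \<bar>a\<bar> * E f r + \<bar>b\<bar> * E g r" for a b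
    using f g r by (rule E_linear_le)
  show "E (\<lambda>x. f (complex_of_real p * x) * g (complex_of_real q * x)) r \<le> E f (r * p) * E g (r * q)"
    using f g assms(3-5) r by (rule E_scaled_mult_le)
  show "E (\<lambda>x. f (complex_of_real p * x)) r \<le> E f (r * p)"
    \<comment> \<open>With the constant 1 as second function, its factor on the right is 1 by
      \<open>E_one\<close>.\<close>
    using E_scaled_mult_le[OF f exp_gf_coeffs_one assms(3-5) r] by (simp add: E_one)
  show "\<exists>D. (E f has_real_derivative D) (at r within {0..}) \<and> \<bar>D\<bar> \<le> E (deriv f) r"
    \<comment> \<open>Restricting the two-sided derivative to \<open>{0..}\<close> also covers the
      endpoint \<open>r = 0\<close>.\<close>
    using E_has_real_derivative[OF f] E_derivative_le[OF hol f r]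
    by (blast intro: has_field_derivative_at_within)
qed

end
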